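(* Let $x_0\in U$ be a Borwein properly efficient solution of NMFP (in particular $x_0\in X$), and let $s=(s_1,\dots,s_p)$ with $s_i=\frac{f_i(x_0)}{F_i(x_0)}$. Suppose that: (i) for all $i\in I$, $j\in J$, $k\in K$, the functions $f_i,F_i,g_j,h_k$ are locally Lipschitz continuous and regular in the sense of Clarke on $U$, and $f_i^{\circ\circ}(x;d)$, $g_j^{\circ\circ}(x;d)$, $h_k^{\circ\circ}(x;d)$ are finite for all $x\in U$ and all $d\in Z$; (ii) for all $i\in I$, $F_i$ is Gâteaux differentiable on $U$ with Gâteaux derivative $F'_{i,G}$, and $F_i''(x;d)$ exists for all $x\in U$ and all $d\in Z$; (iii) $f_i$ $(i\in I)$, $g_j$ $(j\in J)$ and $h_k$ $(k\in K)$ are Gâteaux differentiable at $x_0$, with Gâteaux derivatives $f'_{i,G}(x_0),g'_{j,G}(x_0),h'_{k,G}(x_0)$. Let $v\in D(x_0)$ and suppose the generalized second-order Abadie-type regularity condition $\widetilde C^2(Q,x_0,v)\subseteq\widetilde T^2(X,x_0,v)$ holds. Then there exist $\lambda\in\mathbb{R}^p_{++}$, $\mu\in\mathbb{R}^m_+$ and $\nu\in\mathbb{R}^l$ such that $$\sum_{i=1}^p\lambda_i\big(f'_{i,G}(x_0)-s_iF'_{i,G}(x_0)\big)+\sum_{j=1}^m\mu_jg'_{j,G}(x_0)+\sum_{k=1}^l\nu_kh'_{k,G}(x_0)=0,$$ $$\sum_{i=1}^p\lambda_i\big(f_i^{\circ\circ}(x_0;v)-s_iF_i''(x_0;v)\big)+\sum_{j=1}^m\mu_jg_j^{\circ\circ}(x_0;v)+\sum_{k=1}^l\nu_kh_k^{\circ\circ}(x_0;v)\ge0,$$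 $$\mu_jg_j(x_0)=0\quad\text{and}\quad\mu_j\langle g'_{j,G}(x_0),v\rangle=0,\qquad j=1,\dots,m.$$
   Context: Setting. $Z$ is a real reflexive Banach space with dual $Z^*$ and pairing $\langle\cdot,\cdot\rangle$; $U\subseteq Z$ is nonempty and open; $f,F:Z\to\mathbb{R}^p$, $g:Z\to\mathbb{R}^m$, $h:Z\to\mathbb{R}^l$ have components $f_i,F_i$ ($i\in I=\{1,\dots,p\}$), $g_j$ ($j\in J=\{1,\dots,m\}$), $h_k$ ($k\in K=\{1,\dots,l\}$), and $F_i(x)>0$ for all $x\in U$, $i\in I$. $\frac fF=(\frac{f_1}{F_1},\dots,\frac{f_p}{F_p})^\top$ on $U$. NMFP is the problem of minimizing $\frac{f}{F}$ over $X=\{x\in U: g_j(x)\le0\ \forall j\in J,\ h_k(x)=0\ \forall k\in K\}$. $\mathbb{R}_+=[0,\infty)$; $\mathbb{R}^n_+$ and $\mathbb{R}^n_{++}$ are the nonnegative and positive orthants. Derivatives. For $\vartheta:U\to\mathbb{R}$, $x\in U$, $v\in Z$: $\vartheta'(x;v)=\lim_{t\to0^+}\frac{\vartheta(x+tv)-\vartheta(x)}{t}$; $\vartheta$ is Gâteaux differentiable at $x$ with Gâteaux derivative $\vartheta'_G(x)\in Z^*$ if $\vartheta'(x;v)$ exists and equals $\langle\vartheta'_G(x),v\rangle$ for all $v\in Z$; $\vartheta^{\circ}(x;v)=\limsup_{y\to x,\,t\to0^+}\frac{\vartheta(y+tv)-\vartheta(y)}{t}$ (Clarke); $\vartheta$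 is regular in the sense of Clarke at $x$ if $\vartheta'(x;v)$ exists and equals $\vartheta^\circ(x;v)$ for all $v\in Z$; $\vartheta''(x;v)=\lim_{t\to0^+}\frac{\vartheta(x+tv)-\vartheta(x)-t\vartheta'(x;v)}{\frac12t^2}$ if the limit exists; $\vartheta^{\circ\circ}(x;v)=\limsup_{t\to0^+}\frac{\vartheta(x+tv)-\vartheta(x)-t\vartheta^\circ(x;v)}{\frac12t^2}$ (Páles–Zeidan). Cones. For a subset $A$ of a normed space $Y$ and $a\in A$, the contingent cone is $T(A,a)=\{d\in Y:\exists\,t_k\to0^+,\ d_k\to d,\ a+t_kd_k\in A\ \forall k\}$. For $x_0\in X$, $v\in Z$: $J(x_0)=\{j\in J:g_j(x_0)=0\}$, $J(x_0,v)=\{j\in J(x_0):g_j^\circ(x_0;v)=0\}$; the linearizing cone is $$C(Q,x_0)=\{d\in Z:\ (\tfrac{f_i}{F_i})^\circ(x_0;d)\le0\ \forall i\in I,\ g_j^\circ(x_0;d)\le0\ \forall j\in J(x_0),\ h_k^\circ(x_0;d)=0\ \forall k\in K\}$$ (here $Q$ is only part of the notation); the set of critical points is $D(x_0)=T(X,x_0)\cap C(Q,x_0)$. The projective second-order tangent cone of $X$ at $x_0$ in direction $v$ is $$\widetilde T^2(X,x_0,v)=\{(w,r)\in Z\times\mathbb{R}_+:\exists\,t_k\to0^+,\ r_k\to r,\ w_k\to w\ \text{with } r_k>0,\ \tfrac{t_k}{r_k}\to0^+,\ x_0+t_kv+\tfrac12r_k^{-1}t_k^2w_k\in X\ \forall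 k\}.$$ The projective second-order linearizing cone is $$\widetilde C^2(Q,x_0,v)=\Big\{(w,r)\in Z\times\mathbb{R}_+:\ \begin{array}{l}(\tfrac{f_i}{F_i})^\circ(x_0;w)+r(\tfrac{f_i}{F_i})^{\circ\circ}(x_0;v)\le0\ \forall i\in I,\\ g_j^\circ(x_0;w)+rg_j^{\circ\circ}(x_0;v)\le0\ \forall j\in J(x_0,v),\\ h_k^\circ(x_0;w)+rh_k^{\circ\circ}(x_0;v)=0\ \forall k\in K\end{array}\Big\}.$$ Borwein properly efficient solution. $x_0\in X$ is a Borwein properly efficient solution of NMFP if $T\big((\frac fF)(X)+\mathbb{R}^p_+,\ (\frac fF)(x_0)\big)\cap(-\mathbb{R}^p_+)=\{0\}$. *)

theory Defs
  imports "HOL-Analysis.Analysis" "HOL-Library.Set_Algebras"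
begin

text \<open>The canonical embedding of the space into its bidual is onto. The type argument is
  only a handle on the space.\<close>

definition reflexive_space :: "'z::real_normed_vector itself \<Rightarrow> bool" where
  "reflexive_space _ \<longleftrightarrow>
     (\<forall>\<Phi> :: ('z \<Rightarrow>\<^sub>L real) \<Rightarrow>\<^sub>L real. \<exists>z :: 'z. \<forall>\<phi>.
        blinfun_apply \<Phi> \<phi> = blinfun_apply \<phi> z)"

definition locally_lipschitz_on :: "'z::metric_space set \<Rightarrow> ('z \<Rightarrow> real) \<Rightarrow> bool" where
  "locally_lipschitz_on U \<theta> \<longleftrightarrow>
     (\<forall>x\<in>U. \<exists>e>0. \<exists>L. L-lipschitz_on (ball x e \<inter> U) \<theta>)"

subsection \<open>Generalized derivatives\<close>

text \<open>Functions are total, but every notion below depends only on the values of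
  \<open>\<theta>\<close> near \<open>x\<close>. Directional derivatives that "exist" are finite; the upper limits are
  extended reals.\<close>

definition has_dirderiv ::
  "('z::real_normed_vector \<Rightarrow> real) \<Rightarrow> 'z \<Rightarrow> 'z \<Rightarrow> real \<Rightarrow> bool" where
  "has_dirderiv \<theta> x v D \<longleftrightarrow>
     ((\<lambda>t. (\<theta> (x + t *\<^sub>R v) - \<theta> x) / t) \<longlongrightarrow> D) (at_right 0)"

definition has_gateaux_derivative ::
  "('z::real_normed_vector \<Rightarrow> real) \<Rightarrow> ('z \<Rightarrow>\<^sub>L real) \<Rightarrow> 'z \<Rightarrow> bool" where
  "has_gateaux_derivative \<theta> \<phi> x \<longleftrightarrow> (\<forall>v. has_dirderiv \<theta> x v (blinfun_apply \<phi> v))"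

definition clarke_deriv ::
  "('z::real_normed_vector \<Rightarrow> real) \<Rightarrow> 'z \<Rightarrow> 'z \<Rightarrow> ereal" where
  "clarke_deriv \<theta> x v =
     Limsup (nhds x \<times>\<^sub>F at_right 0) (\<lambda>(y, t). ereal ((\<theta> (y + t *\<^sub>R v) - \<theta> y) / t))"

definition clarke_regular :: "('z::real_normed_vector \<Rightarrow> real) \<Rightarrow> 'z \<Rightarrow> bool" where
  "clarke_regular \<theta> x \<longleftrightarrow>
     (\<forall>v. \<exists>D. has_dirderiv \<theta> x v D \<and> clarke_deriv \<theta> x v = ereal D)"

definition has_second_dirderiv ::
  "('z::real_normed_vector \<Rightarrow> real) \<Rightarrow> 'z \<Rightarrow> 'z \<Rightarrow> real \<Rightarrow> bool" where
  "has_second_dirderiv \<theta> x v S \<longleftrightarrow>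
     (\<exists>D. has_dirderiv \<theta> x v D \<and>
        ((\<lambda>t. (\<theta> (x + t *\<^sub>R v) - \<theta> x - t * D) / (1/2 * t\<^sup>2)) \<longlongrightarrow> S) (at_right 0))"

text \<open>The Pales-Zeidan derivative. The first-order term is subtracted in the extended reals;
  it is finite for locally Lipschitz \<open>\<theta>\<close>.\<close>

definition pz_deriv ::
  "('z::real_normed_vector \<Rightarrow> real) \<Rightarrow> 'z \<Rightarrow> 'z \<Rightarrow> ereal" where
  "pz_deriv \<theta> x v =
     Limsup (at_right 0) (\<lambda>t.
       (ereal (\<theta> (x + t *\<^sub>R v) - \<theta> x) - ereal t * clarke_deriv \<theta> x v) / ereal (1/2 * t\<^sup>2))"

subsection \<open>The fractional problem and its cones\<close>

text \<open>The constraint families are indexed by \<open>{1..m}\<close> and \<open>{1..l}\<close>, so that either of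
  them may be empty; the objectives are indexed by a finite type.\<close>

definition ratio :: "('z \<Rightarrow> real^'p) \<Rightarrow> ('z \<Rightarrow> real^'p) \<Rightarrow> 'z \<Rightarrow> real^'p" where
  "ratio f F x = (\<chi> i. f x $ i / F x $ i)"

definition feasible_set ::
  "'z set \<Rightarrow> nat \<Rightarrow> (nat \<Rightarrow> 'z \<Rightarrow> real) \<Rightarrow> nat \<Rightarrow> (nat \<Rightarrow> 'z \<Rightarrow> real) \<Rightarrow> 'z set" where
  "feasible_set U m g l h =
     {x \<in> U. (\<forall>j\<in>{1..m}. g j x \<le> 0) \<and> (\<forall>k\<in>{1..l}. h k x = 0)}"

definition contingent_cone :: "'a::real_normed_vector set \<Rightarrow> 'a \<Rightarrow> 'a set" where
  "contingent_cone A a =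
     {d. \<exists>(t :: nat \<Rightarrow> real) dk. (\<forall>k. 0 < t k) \<and> t \<longlonglongrightarrow> 0 \<and> dk \<longlonglongrightarrow> d \<and>
        (\<forall>k. a + t k *\<^sub>R dk k \<in> A)}"

definition nonneg_orthant :: "(real^'n) set" where
  "nonneg_orthant = {y. \<forall>i. 0 \<le> y $ i}"

definition borwein_properly_efficient ::
  "('z \<Rightarrow> real^'p) \<Rightarrow> 'z set \<Rightarrow> 'z \<Rightarrow> bool" where
  "borwein_properly_efficient \<psi> X x0 \<longleftrightarrow>
     x0 \<in> X \<and>
     contingent_cone (\<psi> ` X + nonneg_orthant) (\<psi> x0) \<inter> uminus ` nonneg_orthant = {0}"

definition active :: "nat \<Rightarrow> (nat \<Rightarrow> 'z \<Rightarrow> real) \<Rightarrow> 'z \<Rightarrow> nat set" where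
  "active m g x0 = {j \<in> {1..m}. g j x0 = 0}"

definition active_dir ::
  "nat \<Rightarrow> (nat \<Rightarrow> 'z::real_normed_vector \<Rightarrow> real) \<Rightarrow> 'z \<Rightarrow> 'z \<Rightarrow> nat set" where
  "active_dir m g x0 v = {j \<in> active m g x0. clarke_deriv (g j) x0 v = 0}"

definition linearizing_cone ::
  "('z::real_normed_vector \<Rightarrow> real^'p) \<Rightarrow> nat \<Rightarrow> (nat \<Rightarrow> 'z \<Rightarrow> real) \<Rightarrow>
   nat \<Rightarrow> (nat \<Rightarrow> 'z \<Rightarrow> real) \<Rightarrow> 'z \<Rightarrow> 'z set" where
  "linearizing_cone \<psi> m g l h x0 =
     {d. (\<forall>i. clarke_deriv (\<lambda>x. \<psi> x $ i) x0 d \<le> 0) \<and>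
         (\<forall>j\<in>active m g x0. clarke_deriv (g j) x0 d \<le> 0) \<and>
         (\<forall>k\<in>{1..l}. clarke_deriv (h k) x0 d = 0)}"

definition critical_points ::
  "'z::real_normed_vector set \<Rightarrow> ('z \<Rightarrow> real^'p) \<Rightarrow> nat \<Rightarrow> (nat \<Rightarrow> 'z \<Rightarrow> real) \<Rightarrow>
   nat \<Rightarrow> (nat \<Rightarrow> 'z \<Rightarrow> real) \<Rightarrow> 'z \<Rightarrow> 'z set" where
  "critical_points X \<psi> m g l h x0 =
     contingent_cone X x0 \<inter> linearizing_cone \<psi> m g l h x0"

definition proj_second_tangent_cone ::
  "'z::real_normed_vector set \<Rightarrow> 'z \<Rightarrow> 'z \<Rightarrow> ('z \<times> real) set" where
  "proj_second_tangent_cone X x0 v =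
     {(w, r). 0 \<le> r \<and>
        (\<exists>(t :: nat \<Rightarrow> real) (rk :: nat \<Rightarrow> real) wk.
           (\<forall>k. 0 < t k) \<and> t \<longlonglongrightarrow> 0 \<and> rk \<longlonglongrightarrow> r \<and> wk \<longlonglongrightarrow> w \<and>
           (\<forall>k. 0 < rk k) \<and> (\<lambda>k. t k / rk k) \<longlonglongrightarrow> 0 \<and>
           (\<forall>k. x0 + t k *\<^sub>R v + (1/2 * inverse (rk k) * (t k)\<^sup>2) *\<^sub>R wk k \<in> X))}"

definition proj_second_linearizing_cone ::
  "('z::real_normed_vector \<Rightarrow> real^'p) \<Rightarrow> nat \<Rightarrow> (nat \<Rightarrow> 'z \<Rightarrow> real) \<Rightarrow>
   nat \<Rightarrow> (nat \<Rightarrow> 'z \<Rightarrow> real) \<Rightarrow> 'z \<Rightarrow> 'z \<Rightarrow> ('z \<times> real) set" where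
  "proj_second_linearizing_cone \<psi> m g l h x0 v =
     {(w, r). 0 \<le> r \<and>
        (\<forall>i. clarke_deriv (\<lambda>x. \<psi> x $ i) x0 w + ereal r * pz_deriv (\<lambda>x. \<psi> x $ i) x0 v \<le> 0) \<and>
        (\<forall>j\<in>active_dir m g x0 v. clarke_deriv (g j) x0 w + ereal r * pz_deriv (g j) x0 v \<le> 0) \<and>
        (\<forall>k\<in>{1..l}. clarke_deriv (h k) x0 w + ereal r * pz_deriv (h k) x0 v = 0)}"

end

theory Submission
  imports Defs
begin

text \<open>Let \<open>\<psi> = f/F\<close>. Clarke regularity together with Gateaux differentiability at \<open>x0\<close> makes the
  derivatives strict, so difference quotients converge along arbitrary sequences of base points, and
  \<open>\<psi>\<^sub>i\<close> has the strict derivative \<open>(f\<^sub>i' - s\<^sub>i F\<^sub>i') / F\<^sub>i(x0)\<close>. Proper efficiency tested along a sequence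
  realizing \<open>v \<in> T(X, x0)\<close> forces this derivative to vanish at \<open>v\<close>; only then is the second-order
  upper derivative of \<open>\<psi>\<^sub>i\<close> at \<open>v\<close> at most \<open>(f\<^sub>i'' - s\<^sub>i F\<^sub>i'') / F\<^sub>i(x0)\<close>. Hence every \<open>(w, r)\<close> solving the
  linear system in which the second-order terms are multiplied by \<open>r \<ge> 0\<close> lies in the projective
  linearizing cone, so by the regularity condition in the projective tangent cone. Along the
  resulting arcs \<open>x0 + t v + \<tau> w\<close>, with \<open>\<tau> = t\<^sup>2 / 2r\<close>, proper efficiency turns every objective
  inequality of the system into an equality. Tucker's theorem of the alternative on \<open>Z \<times> \<real>\<close> then gives
  the multipliers: \<open>r = 0\<close> is the first-order condition and \<open>w = 0\<close> the second-order one. There are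
  only finitely many functionals, so the algebraic Farkas lemma suffices and no separation theorem
  is needed.\<close>

section \<open>Theorems of the alternative for finitely many linear functionals\<close>

text \<open>Induction on the number of functionals. If the implication survives dropping
  \<open>a n\<close>, this functional gets coefficient 0. Otherwise a point \<open>u\<close> at
  which it fails must have \<open>a n u > 0\<close>, and projecting along \<open>u\<close>
  eliminates \<open>a n\<close>. The argument is purely algebraic, so no closedness of a cone
  enters.\<close>

lemma farkas_linear:
  fixes a :: "'i \<Rightarrow> 'v::real_vector \<Rightarrow> real" and b :: "'v \<Rightarrow> real"
  assumes "finite I" "\<And>i. i \<in> I \<Longrightarrow> linear (a i)" "linear b"
    and "\<And>x. (\<And>i. i \<in> I \<Longrightarrow> a i x \<le> 0) \<Longrightarrow> b x \<le> 0"
  shows "\<exists>c. (\<forall>i\<in>I. 0 \<le> c i) \<and> (\<forall>x. b x = (\<Sum>i\<in>I. c i * a i x))"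
  using assms
proof (induction I arbitrary: a b rule: finite_induct)
  case empty
  have "b x = 0" for x
    using empty.prems(3)[of x] empty.prems(3)[of "-x"] linear_neg[OF empty.prems(2), of x] by simp
  then show ?case by simp
next
  case (insert n I)
  have lin: "linear (a i)" if "i \<in> insert n I" for i using insert.prems(1) that .
  show ?case
  proof (cases "\<forall>x. (\<forall>i\<in>I. a i x \<le> 0) \<longrightarrow> b x \<le> 0")
    case True
    then obtain c where c: "\<forall>i\<in>I. 0 \<le> c i" "\<forall>x. b x = (\<Sum>i\<in>I. c i * a i x)"
      using insert.IH[of a b] lin insert.prems(2) by blast
    have "(\<Sum>i\<in>I. (c(n := 0)) i * a i x) = (\<Sum>i\<in>I. c i * a i x)" for x
      using insert.hyps by (intro sum.cong) auto
    with c insert.hyps show ?thesis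
      by (intro exI[of _ "c(n := 0)"]) auto
  next
    case False
    then obtain u where u: "\<forall>i\<in>I. a i u \<le> 0" "b u > 0" by force
    have nu: "a n u > 0"
      using insert.prems(3)[of u] u by force
    define z where "z = u /\<^sub>R a n u"
    have z: "\<And>i. i \<in> I \<Longrightarrow> a i z \<le> 0" "a n z = 1" "b z > 0"
      using u nu insert.prems(2) lin
      by (auto simp: z_def linear_cmul mult_le_0_iff)
    txt \<open>Project along \<open>z\<close> onto the kernel of \<open>a n\<close>.\<close>
    define a' where "a' i x = a i x - a i z * a n x" for i x
    define b' where "b' x = b x - b z * a n x" for x
    have lina': "linear (a' i)" if "i \<in> I" for i
      unfolding a'_def using lin that
      by (intro linear_compose_sub linear_compose_scale_right[where 'b=real, simplified]) auto
    have linb': "linear b'"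
      unfolding b'_def using lin insert.prems(2)
      by (intro linear_compose_sub linear_compose_scale_right[where 'b=real, simplified]) auto
    have "b' x \<le> 0" if x: "\<And>i. i \<in> I \<Longrightarrow> a' i x \<le> 0" for x
    proof -
      let ?y = "x - a n x *\<^sub>R z"
      have "a i ?y \<le> 0" if "i \<in> insert n I" for i
      proof -
        have "a i ?y = a i x - a n x * a i z"
          using linear_diff[OF lin[OF that]] linear_cmul[OF lin[OF that]] by simp
        then show ?thesis using that x z(2) unfolding a'_def by (auto simp: mult.commute)
      qed
      then have "b ?y \<le> 0" by (rule insert.prems(3))
      moreover have "b ?y = b x - a n x * b z"
        using linear_diff[OF insert.prems(2)] linear_cmul[OF insert.prems(2)] by simp
      ultimately show ?thesis by (simp add: b'_def mult.commute)
    qed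
    then obtain c where c: "\<forall>i\<in>I. 0 \<le> c i" "\<forall>x. b' x = (\<Sum>i\<in>I. c i * a' i x)"
      using insert.IH[of a' b', OF lina' linb'] by auto
    \<comment> \<open>Substituting \<open>a'\<close> and \<open>b'\<close> back collects exactly
      this coefficient at \<open>a n\<close>. It is positive because \<open>b z > 0\<close> and each
      \<open>c i * a i z\<close> is nonpositive.\<close>
    define d where "d = c(n := b z - (\<Sum>i\<in>I. c i * a i z))"
    have "(\<Sum>i\<in>I. c i * a i z) \<le> 0"
      using c(1) z(1) by (intro sum_nonpos) (simp add: mult_nonneg_nonpos)
    then have "\<forall>i\<in>insert n I. 0 \<le> d i"
      using c(1) z(3) by (auto simp: d_def)
    moreover have "b x = (\<Sum>i\<in>insert n I. d i * a i x)" for x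
    proof -
      have "(\<Sum>i\<in>I. d i * a i x) = (\<Sum>i\<in>I. c i * a i x)"
        using insert.hyps by (intro sum.cong) (auto simp: d_def)
      moreover have "b x = b z * a n x + (\<Sum>i\<in>I. c i * a' i x)"
        using spec[OF c(2), of x] unfolding b'_def by linarith
      moreover have "(\<Sum>i\<in>I. c i * a' i x) = (\<Sum>i\<in>I. c i * a i x) - (\<Sum>i\<in>I. c i * a i z) * a n x"
        by (simp add: a'_def right_diff_distrib sum_subtractf sum_distrib_right mult.assoc)
      moreover have "d n = b z - (\<Sum>i\<in>I. c i * a i z)" by (simp add: d_def)
      ultimately show ?thesis
        using insert.hyps by (simp add: left_diff_distrib)
    qed
    ultimately show ?thesis by (intro exI[of _ d]) simp
  qed
qed

text \<open>Each equation is split into two opposite inequalities; the difference of their two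
  nonnegative multipliers has no prescribed sign.\<close>

lemma farkas_linear_mixed:
  fixes a :: "'i \<Rightarrow> 'v::real_vector \<Rightarrow> real" and e :: "'k \<Rightarrow> 'v \<Rightarrow> real" and b :: "'v \<Rightarrow> real"
  assumes fin: "finite I" "finite K"
    and lin: "\<And>i. i \<in> I \<Longrightarrow> linear (a i)" "\<And>k. k \<in> K \<Longrightarrow> linear (e k)" "linear b"
    and imp: "\<And>x. (\<And>i. i \<in> I \<Longrightarrow> a i x \<le> 0) \<Longrightarrow> (\<And>k. k \<in> K \<Longrightarrow> e k x = 0) \<Longrightarrow> b x \<le> 0"
  shows "\<exists>c d. (\<forall>i\<in>I. 0 \<le> c i) \<and> (\<forall>x. b x = (\<Sum>i\<in>I. c i * a i x) + (\<Sum>k\<in>K. d k * e k x))"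
proof -
  define A where "A = case_sum a (case_sum e (\<lambda>k x. - e k x))"
  have "\<exists>c. (\<forall>i\<in>I <+> (K <+> K). 0 \<le> c i) \<and> (\<forall>x. b x = (\<Sum>i\<in>I <+> (K <+> K). c i * A i x))"
  proof (rule farkas_linear)
    show "b x \<le> 0" if "\<And>i. i \<in> I <+> (K <+> K) \<Longrightarrow> A i x \<le> 0" for x
    proof (rule imp)
      show "a i x \<le> 0" if "i \<in> I" for i
        using \<open>\<And>i. i \<in> I <+> (K <+> K) \<Longrightarrow> A i x \<le> 0\<close>[of "Inl i"] that by (auto simp: A_def)
      show "e k x = 0" if "k \<in> K" for k
        using \<open>\<And>i. i \<in> I <+> (K <+> K) \<Longrightarrow> A i x \<le> 0\<close>[of "Inr (Inl k)"]
          \<open>\<And>i. i \<in> I <+> (K <+> K) \<Longrightarrow> A i x \<le> 0\<close>[of "Inr (Inr k)"] that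
        by (auto simp: A_def InlI InrI)
    qed
    show "linear (A i)" if "i \<in> I <+> (K <+> K)" for i
      using that lin linear_compose_neg[OF lin(2)] by (auto simp: A_def)
  qed (use fin lin in auto)
  then obtain c where c: "\<forall>i\<in>I <+> (K <+> K). 0 \<le> c i"
    "\<forall>x. b x = (\<Sum>i\<in>I <+> (K <+> K). c i * A i x)" by blast
  have "b x = (\<Sum>i\<in>I. c (Inl i) * a i x) + (\<Sum>k\<in>K. (c (Inr (Inl k)) - c (Inr (Inr k))) * e k x)" for x
    using c(2) fin by (simp add: sum.Plus A_def algebra_simps sum_subtractf sum_negf)
  moreover have "\<forall>i\<in>I. 0 \<le> c (Inl i)" using c(1) by (auto intro: InlI)
  ultimately show ?thesis
    by (intro exI[of _ "\<lambda>i. c (Inl i)"] exI[of _ "\<lambda>k. c (Inr (Inl k)) - c (Inr (Inr k))"]) simp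
qed

text \<open>The hypothesis says that no solution of the system makes any \<open>p i\<close> strictly
  negative. Farkas' lemma is applied to \<open>- p q\<close> for each \<open>q\<close> separately,
  and the resulting identities are added. Every \<open>p i\<close> then carries its own 1 plus
  nonnegative contributions, which is the source of the strict positivity.\<close>

lemma tucker_alternative:
  fixes p :: "'i \<Rightarrow> 'v::real_vector \<Rightarrow> real" and a :: "'j \<Rightarrow> 'v \<Rightarrow> real" and e :: "'k \<Rightarrow> 'v \<Rightarrow> real"
  assumes fin: "finite I" "finite J" "finite K"
    and lin: "\<And>i. i \<in> I \<Longrightarrow> linear (p i)" "\<And>j. j \<in> J \<Longrightarrow> linear (a j)" "\<And>k. k \<in> K \<Longrightarrow> linear (e k)"
    and imp: "\<And>x i. (\<And>i. i \<in> I \<Longrightarrow> p i x \<le> 0) \<Longrightarrow> (\<And>j. j \<in> J \<Longrightarrow> a j x \<le> 0) \<Longrightarrow>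
      (\<And>k. k \<in> K \<Longrightarrow> e k x = 0) \<Longrightarrow> i \<in> I \<Longrightarrow> p i x = 0"
  shows "\<exists>lam \<mu> \<nu>. (\<forall>i\<in>I. 0 < lam i) \<and> (\<forall>j\<in>J. 0 \<le> \<mu> j) \<and>
    (\<forall>x. (\<Sum>i\<in>I. lam i * p i x) + (\<Sum>j\<in>J. \<mu> j * a j x) + (\<Sum>k\<in>K. \<nu> k * e k x) = 0)"
proof -
  define P where "P q c d \<longleftrightarrow> (\<forall>i\<in>I <+> J. 0 \<le> c i) \<and>
      (\<forall>x. - p q x = (\<Sum>i\<in>I <+> J. c i * case_sum p a i x) + (\<Sum>k\<in>K. d k * e k x))"
    for q and c :: "'i + 'j \<Rightarrow> real" and d :: "'k \<Rightarrow> real"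
  have "\<exists>c d. P q c d" if q: "q \<in> I" for q
    unfolding P_def
  proof (rule farkas_linear_mixed)
    show "- p q x \<le> 0"
      if A: "\<And>i. i \<in> I <+> J \<Longrightarrow> case_sum p a i x \<le> 0" and E: "\<And>k. k \<in> K \<Longrightarrow> e k x = 0" for x
    proof -
      have "p i x \<le> 0" if "i \<in> I" for i using A[OF InlI[OF that]] by simp
      moreover have "a j x \<le> 0" if "j \<in> J" for j using A[OF InrI[OF that]] by simp
      ultimately have "p q x = 0" using E q by (intro imp) auto
      then show ?thesis by simp
    qed
    show "linear (case_sum p a i)" if "i \<in> I <+> J" for i using that lin by auto
    show "linear (\<lambda>x. - p q x)" using lin(1)[OF q] by (rule linear_compose_neg)
  qed (use fin lin in auto)
  then have "\<exists>c d. \<forall>q\<in>I. P q (c q) (d q)" by metis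
  then obtain c d where P: "\<And>q. q \<in> I \<Longrightarrow> P q (c q) (d q)" by auto
  have c: "0 \<le> c q i" if "q \<in> I" "i \<in> I <+> J" for q i
    using P[OF that(1)] that(2) unfolding P_def by simp
  have eq: "- p q x = (\<Sum>i\<in>I. c q (Inl i) * p i x) + (\<Sum>j\<in>J. c q (Inr j) * a j x)
      + (\<Sum>k\<in>K. d q k * e k x)" if "q \<in> I" for q x
    using P[OF that] fin unfolding P_def by (simp add: sum.Plus)
  have "(\<Sum>i\<in>I. (1 + (\<Sum>q\<in>I. c q (Inl i))) * p i x) + (\<Sum>j\<in>J. (\<Sum>q\<in>I. c q (Inr j)) * a j x)
      + (\<Sum>k\<in>K. (\<Sum>q\<in>I. d q k) * e k x) = 0" for x
  proof -
    have swap: "(\<Sum>q\<in>I. \<Sum>i\<in>N. w q i * y i) = (\<Sum>i\<in>N. (\<Sum>q\<in>I. w q i) * y i)"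
      for N :: "'n set" and w :: "'i \<Rightarrow> 'n \<Rightarrow> real" and y
      unfolding sum_distrib_right by (rule sum.swap)
    have "(\<Sum>q\<in>I. - p q x) = (\<Sum>q\<in>I. (\<Sum>i\<in>I. c q (Inl i) * p i x) + (\<Sum>j\<in>J. c q (Inr j) * a j x)
        + (\<Sum>k\<in>K. d q k * e k x))"
      by (intro sum.cong refl eq)
    also have "\<dots> = (\<Sum>i\<in>I. (\<Sum>q\<in>I. c q (Inl i)) * p i x) + (\<Sum>j\<in>J. (\<Sum>q\<in>I. c q (Inr j)) * a j x)
        + (\<Sum>k\<in>K. (\<Sum>q\<in>I. d q k) * e k x)"
      unfolding sum.distrib swap ..
    finally show ?thesis
      by (simp add: distrib_right sum.distrib sum_negf)
  qed
  moreover have "\<forall>i\<in>I. 0 < 1 + (\<Sum>q\<in>I. c q (Inl i))" "\<forall>j\<in>J. 0 \<le> (\<Sum>q\<in>I. c q (Inr j))"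
    using c by (auto intro!: sum_nonneg add_pos_nonneg InlI InrI)
  ultimately show ?thesis
    by (intro exI[of _ "\<lambda>i. 1 + (\<Sum>q\<in>I. c q (Inl i))"] exI[of _ "\<lambda>j. \<Sum>q\<in>I. c q (Inr j)"]
        exI[of _ "\<lambda>k. \<Sum>q\<in>I. d q k"]) simp
qed

section \<open>Strict derivatives and the first-order quotient rule\<close>

lemma locally_lipschitz_onE:
  assumes "locally_lipschitz_on U \<theta>" "open U" "x \<in> U"
  obtains e L where "0 < e" "L-lipschitz_on (ball x e) \<theta>"
proof -
  obtain e L where e: "0 < e" "L-lipschitz_on (ball x e \<inter> U) \<theta>"
    using assms unfolding locally_lipschitz_on_def by blast
  obtain d where "0 < d" "ball x d \<subseteq> U" using assms open_contains_ball by blast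
  then have "ball x (min e d) \<subseteq> ball x e \<inter> U" by auto
  from that[OF _ lipschitz_on_subset[OF e(2) this]] \<open>0 < d\<close> e(1) show thesis by simp
qed

lemma locally_lipschitz_on_isCont:
  assumes "locally_lipschitz_on U \<theta>" "open U" "x \<in> U"
  shows "isCont \<theta> x"
proof -
  obtain e L where "0 < e" "L-lipschitz_on (ball x e) \<theta>"
    using locally_lipschitz_onE[OF assms] .
  then show ?thesis
    using lipschitz_on_continuous_on continuous_on_eq_continuous_at[of "ball x e"] by fastforce
qed

lemma has_dirderiv_unique:
  "has_dirderiv \<theta> x w D \<Longrightarrow> has_dirderiv \<theta> x w E \<Longrightarrow> D = E"
  unfolding has_dirderiv_def by (rule tendsto_unique[rotated]) auto

lemma clarke_deriv_gateaux:
  assumes "clarke_regular \<theta> x" "has_gateaux_derivative \<theta> \<phi> x"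
  shows "clarke_deriv \<theta> x w = ereal (blinfun_apply \<phi> w)"
  using assms has_dirderiv_unique unfolding clarke_regular_def has_gateaux_derivative_def by metis

text \<open>Regularity makes the Clarke derivative equal to the linear map \<open>\<phi>\<close>, so
  the upper limits in directions \<open>w\<close> and \<open>- w\<close> are opposite numbers.
  Moving the base point turns the second one into a lower limit in direction \<open>w\<close>, which
  therefore agrees with the upper limit.\<close>

lemma strict_derivative:
  assumes "clarke_regular \<theta> x" "has_gateaux_derivative \<theta> \<phi> x"
  shows "((\<lambda>(y, t). (\<theta> (y + t *\<^sub>R w) - \<theta> y) / t) \<longlongrightarrow> blinfun_apply \<phi> w) (nhds x \<times>\<^sub>F at_right 0)"
proof -
  let ?F = "nhds x \<times>\<^sub>F at_right (0::real)"
  have up: "eventually (\<lambda>(y, t). (\<theta> (y + t *\<^sub>R u) - \<theta> y) / t < c) ?F" if "blinfun_apply \<phi> u < c" for u c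
  proof -
    have "clarke_deriv \<theta> x u \<le> ereal (blinfun_apply \<phi> u)"
      using clarke_deriv_gateaux[OF assms] by simp
    then show ?thesis
      unfolding clarke_deriv_def Limsup_le_iff using that
      by (auto dest!: spec[of _ "ereal c"] elim!: eventually_mono)
  qed
  have fst: "filterlim fst (nhds x) ?F" and snd: "filterlim snd (at_right 0) ?F"
    by (auto simp: filterlim_fst filterlim_snd)
  have "(snd \<longlongrightarrow> 0) ?F" using snd by (simp add: filterlim_at)
  then have "((\<lambda>z. fst z + snd z *\<^sub>R w) \<longlongrightarrow> x + 0 *\<^sub>R w) ?F"
    by (intro tendsto_intros fst)
  \<comment> \<open>Base points moved by \<open>t w\<close> still converge to \<open>x\<close>, so
    whatever holds eventually along the product filter also holds eventually at the moved
    points.\<close>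
  then have shift: "filterlim (\<lambda>z. (fst z + snd z *\<^sub>R w, snd z)) ?F ?F"
    by (intro filterlim_Pair snd) simp
  show ?thesis
  proof (rule order_tendstoI)
    fix c assume "blinfun_apply \<phi> w < c"
    from up[OF this] show "eventually (\<lambda>z. (case z of (y, t) \<Rightarrow> (\<theta> (y + t *\<^sub>R w) - \<theta> y) / t) < c) ?F"
      by (rule eventually_mono) auto
  next
    txt \<open>The lower bound is the upper bound in direction \<open>- w\<close> with base point \<open>y + t w\<close>.\<close>
    fix c assume "c < blinfun_apply \<phi> w"
    then have "eventually (\<lambda>(y, t). (\<theta> (y + t *\<^sub>R - w) - \<theta> y) / t < - c) ?F"
      by (intro up) (simp add: blinfun.minus_right)
    from filterlim_iff[THEN iffD1, OF shift, rule_format, OF this]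
    show "eventually (\<lambda>z. c < (case z of (y, t) \<Rightarrow> (\<theta> (y + t *\<^sub>R w) - \<theta> y) / t)) ?F"
    proof (rule eventually_mono)
      fix z :: "'a \<times> real"
      obtain y t where "z = (y, t)" by force
      moreover have "(\<theta> y - \<theta> (y + t *\<^sub>R w)) / t = - ((\<theta> (y + t *\<^sub>R w) - \<theta> y) / t)"
        by (metis minus_diff_eq minus_divide_left)
      ultimately show "(case (fst z + snd z *\<^sub>R w, snd z) of (y, t) \<Rightarrow> (\<theta> (y + t *\<^sub>R - w) - \<theta> y) / t < - c)
          \<Longrightarrow> c < (case z of (y, t) \<Rightarrow> (\<theta> (y + t *\<^sub>R w) - \<theta> y) / t)"
        by simp
    qed
  qed
qed

lemma strict_derivative_sequence:
  fixes \<theta> :: "'z::real_normed_vector \<Rightarrow> real"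
  assumes "clarke_regular \<theta> x" "has_gateaux_derivative \<theta> \<phi> x"
    and "locally_lipschitz_on U \<theta>" "open U" "x \<in> U"
    and y: "y \<longlonglongrightarrow> x" and t: "t \<longlonglongrightarrow> 0" "\<And>k. 0 < t k" and w: "wk \<longlonglongrightarrow> w"
  shows "(\<lambda>k. (\<theta> (y k + t k *\<^sub>R wk k) - \<theta> (y k)) / t k) \<longlonglongrightarrow> blinfun_apply \<phi> w"
proof -
  have "filterlim t (at_right 0) sequentially"
    using t by (auto simp: filterlim_at less_imp_neq[symmetric] intro!: always_eventually)
  then have "filterlim (\<lambda>k. (y k, t k)) (nhds x \<times>\<^sub>F at_right 0) sequentially"
    using y by (intro filterlim_Pair)
  from filterlim_compose[OF strict_derivative[OF assms(1,2), of w] this]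
  have lim: "(\<lambda>k. (\<theta> (y k + t k *\<^sub>R w) - \<theta> (y k)) / t k) \<longlonglongrightarrow> blinfun_apply \<phi> w" by simp
  obtain e L where e: "0 < e" and L: "L-lipschitz_on (ball x e) \<theta>"
    using locally_lipschitz_onE[OF assms(3-5)] .
  have "(\<lambda>k. y k + t k *\<^sub>R wk k) \<longlonglongrightarrow> x + 0 *\<^sub>R w" "(\<lambda>k. y k + t k *\<^sub>R w) \<longlonglongrightarrow> x + 0 *\<^sub>R w"
    by (intro tendsto_intros y t w)+
  then have ev: "\<forall>\<^sub>F k in sequentially. y k + t k *\<^sub>R wk k \<in> ball x e"
    "\<forall>\<^sub>F k in sequentially. y k + t k *\<^sub>R w \<in> ball x e"
    using e by (auto dest!: topological_tendstoD[of _ _ _ "ball x e"])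
  \<comment> \<open>Replacing the varying direction by its limit costs at most
    \<open>L * norm (wk k - w)\<close>, since both points eventually lie in the ball on which
    \<open>L\<close> is a Lipschitz constant.\<close>
  have "(\<lambda>k. (\<theta> (y k + t k *\<^sub>R wk k) - \<theta> (y k + t k *\<^sub>R w)) / t k) \<longlonglongrightarrow> 0"
  proof (rule Lim_null_comparison)
    show "\<forall>\<^sub>F k in sequentially. norm ((\<theta> (y k + t k *\<^sub>R wk k) - \<theta> (y k + t k *\<^sub>R w)) / t k) \<le> L * norm (wk k - w)"
      using ev
    proof eventually_elim
      case (elim k)
      have "\<bar>\<theta> (y k + t k *\<^sub>R wk k) - \<theta> (y k + t k *\<^sub>R w)\<bar> \<le> L * norm (t k *\<^sub>R (wk k - w))"
        using lipschitz_onD[OF L elim] by (simp add: dist_norm scaleR_diff_right)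
      then show ?case using t(2)[of k]
        by (simp add: pos_divide_le_eq abs_divide mult.assoc mult.left_commute mult.commute del: scaleR_diff_right)
    qed
    have "(\<lambda>k. L * norm (wk k - w)) \<longlonglongrightarrow> L * norm (w - w)" by (intro tendsto_intros w)
    then show "(\<lambda>k. L * norm (wk k - w)) \<longlonglongrightarrow> 0" by simp
  qed
  from tendsto_add[OF lim this] show ?thesis by (simp add: add_divide_distrib[symmetric])
qed

text \<open>Stated for an arbitrary filter, with \<open>a\<close>, \<open>b\<close> as values at the
  base point and \<open>a'\<close>, \<open>b'\<close> at the moved point, so that it serves both the
  product filter behind the Clarke derivative and plain sequences.\<close>

lemma quotient_rule:
  fixes a a' b b' c :: "'i \<Rightarrow> real"
  assumes "((\<lambda>i. (a' i - a i) / c i) \<longlongrightarrow> D) G" "((\<lambda>i. (b' i - b i) / c i) \<longlongrightarrow> E) G"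
    and "(a \<longlongrightarrow> A) G" "(b \<longlongrightarrow> B) G" "(b' \<longlongrightarrow> B) G" "B \<noteq> 0"
  shows "((\<lambda>i. (a' i / b' i - a i / b i) / c i) \<longlongrightarrow> (D - A / B * E) / B) G"
proof -
  have "((\<lambda>i. ((a' i - a i) / c i - a i / b i * ((b' i - b i) / c i)) / b' i) \<longlongrightarrow> (D - A / B * E) / B) G"
    by (intro tendsto_intros assms)
  moreover have "\<forall>\<^sub>F i in G. b i \<noteq> 0" "\<forall>\<^sub>F i in G. b' i \<noteq> 0"
    using assms(4-6) tendsto_imp_eventually_ne by blast+
  then have "\<forall>\<^sub>F i in G. ((a' i - a i) / c i - a i / b i * ((b' i - b i) / c i)) / b' i
      = (a' i / b' i - a i / b i) / c i"
  proof eventually_elim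
    case (elim i)
    \<comment> \<open>True for all reals because division by zero yields zero; in particular
      \<open>c i\<close> may vanish.\<close>
    have scale: "(X / w - q * (Y / w)) / B = (X - q * Y) / B / w" for X Y q B w :: real
      by (simp add: divide_inverse algebra_simps)
    have "((a' i - a i) / c i - a i / b i * ((b' i - b i) / c i)) / b' i
        = ((a' i - a i) - a i / b i * (b' i - b i)) / b' i / c i"
      by (rule scale)
    also have "((a' i - a i) - a i / b i * (b' i - b i)) / b' i = a' i / b' i - a i / b i"
      using elim by (simp add: field_simps)
    finally show ?case .
  qed
  ultimately show ?thesis by (rule Lim_transform_eventually)
qed

text \<open>Upper limits in general obey no exact quotient rule. Here both parts are strictly
  differentiable, so the quotient has a genuine limit along the product filter, and the upper limit
  equals it.\<close>

lemma clarke_deriv_quotient: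
  assumes "clarke_regular \<theta> x" "has_gateaux_derivative \<theta> \<phi> x" "isCont \<theta> x"
    and "clarke_regular \<eta> x" "has_gateaux_derivative \<eta> \<rho> x" "isCont \<eta> x" "\<eta> x \<noteq> 0"
  shows "clarke_deriv (\<lambda>y. \<theta> y / \<eta> y) x w =
    ereal ((blinfun_apply \<phi> w - \<theta> x / \<eta> x * blinfun_apply \<rho> w) / \<eta> x)"
proof -
  let ?F = "nhds x \<times>\<^sub>F at_right (0::real)"
  have fst: "(fst \<longlongrightarrow> x) ?F" and snd: "(snd \<longlongrightarrow> 0) ?F"
    using filterlim_snd[of "at_right (0::real)" "nhds x"] by (auto simp: filterlim_fst filterlim_at)
  have "((\<lambda>z. fst z + snd z *\<^sub>R w) \<longlongrightarrow> x + 0 *\<^sub>R w) ?F"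
    by (intro tendsto_intros fst snd)
  then have id: "((\<lambda>z. fst z + snd z *\<^sub>R w) \<longlongrightarrow> x) ?F" by simp
  have \<eta>: "((\<lambda>z. \<eta> (fst z + snd z *\<^sub>R w)) \<longlongrightarrow> \<eta> x) ?F"
    using isCont_tendsto_compose[OF assms(6) id] .
  have "((\<lambda>z. (\<theta> (fst z + snd z *\<^sub>R w) / \<eta> (fst z + snd z *\<^sub>R w) - \<theta> (fst z) / \<eta> (fst z)) / snd z) \<longlongrightarrow>
      (blinfun_apply \<phi> w - \<theta> x / \<eta> x * blinfun_apply \<rho> w) / \<eta> x) ?F"
    using strict_derivative[OF assms(1,2), of w] strict_derivative[OF assms(4,5), of w]
    unfolding case_prod_beta
    by (intro quotient_rule \<eta> isCont_tendsto_compose[OF assms(3)] isCont_tendsto_compose[OF assms(6)] fst assms(7))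
  then show ?thesis
    unfolding clarke_deriv_def case_prod_beta
    by (intro lim_imp_Limsup) (auto simp: prod_filter_eq_bot)
qed

section \<open>Second-order upper derivatives\<close>

text \<open>A finite Clarke derivative turns the extended-real difference into a real one. Read
  forwards, the equivalence yields bounds for the numerators; read backwards, it bounds the
  second-order derivative of the ratio.\<close>

lemma pz_deriv_le_iff:
  assumes "clarke_deriv \<theta> x v = ereal D"
  shows "pz_deriv \<theta> x v \<le> ereal A \<longleftrightarrow>
    (\<forall>c>A. \<forall>\<^sub>F t in at_right 0. (\<theta> (x + t *\<^sub>R v) - \<theta> x - t * D) / (1/2 * t\<^sup>2) < c)"
proof -
  have eq: "pz_deriv \<theta> x v =
      Limsup (at_right 0) (\<lambda>t. ereal ((\<theta> (x + t *\<^sub>R v) - \<theta> x - t * D) / (1/2 * t\<^sup>2)))"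
    unfolding pz_deriv_def assms
    by (rule Limsup_eq) (auto simp: eventually_at_filter)
  show ?thesis
  proof
    assume "pz_deriv \<theta> x v \<le> ereal A"
    then have *: "\<forall>\<^sub>F t in at_right 0. ereal ((\<theta> (x + t *\<^sub>R v) - \<theta> x - t * D) / (1/2 * t\<^sup>2)) < ereal c"
      if "A < c" for c
      unfolding eq Limsup_le_iff by (elim allE[of _ "ereal c"] impE) (simp add: that)
    show "\<forall>c>A. \<forall>\<^sub>F t in at_right 0. (\<theta> (x + t *\<^sub>R v) - \<theta> x - t * D) / (1/2 * t\<^sup>2) < c"
      using * unfolding less_ereal.simps by (intro allI impI)
  next
    assume *: "\<forall>c>A. \<forall>\<^sub>F t in at_right 0. (\<theta> (x + t *\<^sub>R v) - \<theta> x - t * D) / (1/2 * t\<^sup>2) < c"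
    show "pz_deriv \<theta> x v \<le> ereal A"
      unfolding eq
    proof (rule ereal_le_epsilon2)
      fix e :: real assume "0 < e"
      with * have "\<forall>\<^sub>F t in at_right 0. (\<theta> (x + t *\<^sub>R v) - \<theta> x - t * D) / (1/2 * t\<^sup>2) < A + e" by simp
      then show "Limsup (at_right 0) (\<lambda>t. ereal ((\<theta> (x + t *\<^sub>R v) - \<theta> x - t * D) / (1/2 * t\<^sup>2)))
          \<le> ereal A + ereal e"
        by (intro Limsup_bounded) (auto elim: eventually_mono)
    qed
  qed
qed

text \<open>By \<open>crit\<close> the first-order terms of numerator and denominator cancel,
  leaving a combination of second-order quotients. The numerator contributes only an upper bound.
  The denominator has a true second-order limit, so the factor \<open>q\<close> may have either
  sign.\<close>

lemma pz_quotient_upper_bound: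
  assumes "clarke_regular \<theta> x" "has_gateaux_derivative \<theta> \<phi> x"
    and \<eta>: "has_second_dirderiv \<eta> x v S" "has_gateaux_derivative \<eta> \<rho> x" "isCont \<eta> x" "0 < \<eta> x"
    and pz: "pz_deriv \<theta> x v \<le> ereal A"
    and crit: "blinfun_apply \<phi> v = \<theta> x / \<eta> x * blinfun_apply \<rho> v"
    and c: "(A - \<theta> x / \<eta> x * S) / \<eta> x < c"
  shows "\<forall>\<^sub>F t in at_right 0. (\<theta> (x + t *\<^sub>R v) / \<eta> (x + t *\<^sub>R v) - \<theta> x / \<eta> x) / (1/2 * t\<^sup>2) < c"
proof -
  define q where "q = \<theta> x / \<eta> x"
  \<comment> \<open>The upper limit bounds the numerator's quotient only by numbers strictly above
    \<open>A\<close>, so an intermediate \<open>d\<close> is inserted.\<close>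
  obtain d where d: "A < d" "(d - q * S) / \<eta> x < c"
  proof -
    have "A < c * \<eta> x + q * S" using c \<eta>(4) by (simp add: q_def field_simps)
    then obtain d where "A < d" "d < c * \<eta> x + q * S" using dense by blast
    then show thesis using that \<eta>(4) by (simp add: field_simps)
  qed
  have id: "((\<lambda>t. x + t *\<^sub>R v) \<longlongrightarrow> x + 0 *\<^sub>R v) (at_right (0::real))"
    by (intro tendsto_intros)
  then have cont: "((\<lambda>t. \<eta> (x + t *\<^sub>R v)) \<longlongrightarrow> \<eta> x) (at_right (0::real))"
    using isCont_tendsto_compose[OF \<eta>(3)] by simp
  \<comment> \<open>The first-order term hidden in \<open>has_second_dirderiv\<close> is
    existentially quantified; uniqueness of limits identifies it with the Gateaux
    derivative.\<close>
  have S: "((\<lambda>t. (\<eta> (x + t *\<^sub>R v) - \<eta> x - t * blinfun_apply \<rho> v) / (1/2 * t\<^sup>2)) \<longlongrightarrow> S) (at_right 0)"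
  proof -
    obtain D where D: "has_dirderiv \<eta> x v D"
      "((\<lambda>t. (\<eta> (x + t *\<^sub>R v) - \<eta> x - t * D) / (1/2 * t\<^sup>2)) \<longlongrightarrow> S) (at_right 0)"
      using \<eta>(1) unfolding has_second_dirderiv_def by blast
    have "D = blinfun_apply \<rho> v"
      using has_dirderiv_unique[OF D(1)] \<eta>(2) unfolding has_gateaux_derivative_def by simp
    with D(2) show ?thesis by simp
  qed
  have "((\<lambda>t. (d - q * ((\<eta> (x + t *\<^sub>R v) - \<eta> x - t * blinfun_apply \<rho> v) / (1/2 * t\<^sup>2))) / \<eta> (x + t *\<^sub>R v))
      \<longlongrightarrow> (d - q * S) / \<eta> x) (at_right 0)"
    using \<eta>(4) by (intro tendsto_intros S cont) simp
  from order_tendstoD(2)[OF this d(2)] order_tendstoD(1)[OF cont \<eta>(4)]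
    pz_deriv_le_iff[OF clarke_deriv_gateaux[OF assms(1,2)], THEN iffD1, rule_format, OF pz d(1)]
    eventually_at_right_less[of 0]
  show ?thesis
  proof eventually_elim
    case (elim t)
    let ?a = "(\<theta> (x + t *\<^sub>R v) - \<theta> x - t * blinfun_apply \<phi> v) / (1/2 * t\<^sup>2)"
    let ?b = "(\<eta> (x + t *\<^sub>R v) - \<eta> x - t * blinfun_apply \<rho> v) / (1/2 * t\<^sup>2)"
    have "(\<theta> (x + t *\<^sub>R v) / \<eta> (x + t *\<^sub>R v) - \<theta> x / \<eta> x) / (1/2 * t\<^sup>2) = (?a - q * ?b) / \<eta> (x + t *\<^sub>R v)"
      using elim(2,4) \<eta>(4) unfolding crit by (simp add: q_def field_simps)
    also have "\<dots> < (d - q * ?b) / \<eta> (x + t *\<^sub>R v)"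
      using elim(2,3) by (simp add: divide_strict_right_mono)
    finally show ?case using elim(1) by simp
  qed
qed

section \<open>Proper efficiency along sequences and second-order arcs\<close>

text \<open>The cone is taken of the image plus the orthant, so upper bounds on the difference
  quotients suffice. This matters for the second-order quotients, which need not converge.\<close>

lemma borwein_upper_limit_eq_0:
  fixes \<psi> :: "'z \<Rightarrow> real^'p"
  assumes eff: "borwein_properly_efficient \<psi> X x0"
    and \<tau>: "\<And>k. 0 < \<tau> k" "\<tau> \<longlonglongrightarrow> 0" and x: "\<And>k. x k \<in> X"
    and up: "\<And>i c. b $ i < c \<Longrightarrow> \<forall>\<^sub>F k in sequentially. (\<psi> (x k) $ i - \<psi> x0 $ i) / \<tau> k < c"
    and b: "\<And>i. b $ i \<le> 0"
  shows "b = 0"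
proof -
  txt \<open>Adding the orthant to the image lets the difference quotients be raised to converge to \<open>b\<close>.\<close>
  define d where "d k = (\<chi> i. max ((\<psi> (x k) $ i - \<psi> x0 $ i) / \<tau> k) (b $ i))" for k
  have "d \<longlonglongrightarrow> b"
  proof (rule vec_tendstoI, rule order_tendstoI)
    fix i c assume "c < b $ i"
    then show "\<forall>\<^sub>F k in sequentially. c < d k $ i" by (simp add: d_def less_max_iff_disj)
  next
    fix i c assume "b $ i < c"
    with up[OF this] show "\<forall>\<^sub>F k in sequentially. d k $ i < c" by (simp add: d_def)
  qed
  moreover have "\<psi> x0 + \<tau> k *\<^sub>R d k \<in> \<psi> ` X + nonneg_orthant" for k
  proof -
    have "\<psi> x0 + \<tau> k *\<^sub>R d k - \<psi> (x k) \<in> nonneg_orthant"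
    proof -
      have "\<psi> (x k) $ i - \<psi> x0 $ i \<le> \<tau> k * d k $ i" for i
      proof -
        have "(\<psi> (x k) $ i - \<psi> x0 $ i) / \<tau> k \<le> d k $ i" by (simp add: d_def)
        then show ?thesis using \<tau>(1)[of k] by (simp add: field_simps)
      qed
      then show ?thesis by (simp add: nonneg_orthant_def algebra_simps)
    qed
    from set_plus_intro[OF imageI[OF x[of k], of \<psi>] this] show ?thesis by simp
  qed
  ultimately have "b \<in> contingent_cone (\<psi> ` X + nonneg_orthant) (\<psi> x0)"
    unfolding contingent_cone_def using \<tau> by blast
  moreover have "b \<in> uminus ` nonneg_orthant"
    using b by (intro image_eqI[of _ _ "- b"]) (auto simp: nonneg_orthant_def)
  ultimately show ?thesis
    using eff unfolding borwein_properly_efficient_def by (metis IntI singletonD)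
qed

lemma strict_derivative_quotient_sequence:
  fixes \<theta> \<eta> :: "'z::real_normed_vector \<Rightarrow> real"
  assumes \<theta>: "clarke_regular \<theta> x" "has_gateaux_derivative \<theta> \<phi> x" "locally_lipschitz_on U \<theta>"
    and \<eta>: "clarke_regular \<eta> x" "has_gateaux_derivative \<eta> \<rho> x" "locally_lipschitz_on U \<eta>" "\<eta> x \<noteq> 0"
    and U: "open U" "x \<in> U"
    and y: "y \<longlonglongrightarrow> x" and t: "t \<longlonglongrightarrow> 0" "\<And>k. 0 < t k" and w: "wk \<longlonglongrightarrow> w"
  shows "(\<lambda>k. (\<theta> (y k + t k *\<^sub>R wk k) / \<eta> (y k + t k *\<^sub>R wk k) - \<theta> (y k) / \<eta> (y k)) / t k)
    \<longlonglongrightarrow> (blinfun_apply \<phi> w - \<theta> x / \<eta> x * blinfun_apply \<rho> w) / \<eta> x"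
proof (rule quotient_rule)
  have "(\<lambda>k. y k + t k *\<^sub>R wk k) \<longlonglongrightarrow> x + 0 *\<^sub>R w"
    by (intro tendsto_intros y t w)
  then have lim: "(\<lambda>k. y k + t k *\<^sub>R wk k) \<longlonglongrightarrow> x" by simp
  show "(\<lambda>k. (\<theta> (y k + t k *\<^sub>R wk k) - \<theta> (y k)) / t k) \<longlonglongrightarrow> blinfun_apply \<phi> w"
    by (rule strict_derivative_sequence[OF \<theta> U y t w])
  show "(\<lambda>k. (\<eta> (y k + t k *\<^sub>R wk k) - \<eta> (y k)) / t k) \<longlonglongrightarrow> blinfun_apply \<rho> w"
    by (rule strict_derivative_sequence[OF \<eta>(1-3) U y t w])
  show "(\<lambda>k. \<theta> (y k)) \<longlonglongrightarrow> \<theta> x"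
    by (rule isCont_tendsto_compose[OF locally_lipschitz_on_isCont[OF \<theta>(3) U] y])
  show "(\<lambda>k. \<eta> (y k)) \<longlonglongrightarrow> \<eta> x"
    by (rule isCont_tendsto_compose[OF locally_lipschitz_on_isCont[OF \<eta>(3) U] y])
  show "(\<lambda>k. \<eta> (y k + t k *\<^sub>R wk k)) \<longlonglongrightarrow> \<eta> x"
    by (rule isCont_tendsto_compose[OF locally_lipschitz_on_isCont[OF \<eta>(3) U] lim])
  show "\<eta> x \<noteq> 0" by (rule \<eta>(4))
qed

text \<open>The increment is split at \<open>x + t v\<close>. The outer piece has limit
  \<open>D\<close>; the inner piece over \<open>\<tau>\<close> is \<open>rk\<close> times the
  second-order quotient, because \<open>t^2 / 2 = rk * \<tau>\<close>.\<close>

lemma second_order_arc_upper_bound: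
  fixes \<psi> :: "'z::real_normed_vector \<Rightarrow> real"
  assumes t: "t \<longlonglongrightarrow> 0" "\<And>k. 0 < t k" and r: "rk \<longlonglongrightarrow> r" "\<And>k. 0 < rk k"
    and \<tau>: "\<And>k. \<tau> k = 1/2 * inverse (rk k) * (t k)\<^sup>2"
    and D: "(\<lambda>k. (\<psi> (x + t k *\<^sub>R v + \<tau> k *\<^sub>R wk k) - \<psi> (x + t k *\<^sub>R v)) / \<tau> k) \<longlonglongrightarrow> D"
    and A: "\<And>c. A < c \<Longrightarrow> \<forall>\<^sub>F t in at_right 0. (\<psi> (x + t *\<^sub>R v) - \<psi> x) / (1/2 * t\<^sup>2) < c"
    and c: "D + r * A < c"
  shows "\<forall>\<^sub>F k in sequentially. (\<psi> (x + t k *\<^sub>R v + \<tau> k *\<^sub>R wk k) - \<psi> x) / \<tau> k < c"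
proof -
  \<comment> \<open>The bound \<open>d > A\<close> is found by continuity rather than by dividing by
    \<open>r\<close>, which may be zero.\<close>
  have "((\<lambda>d. D + r * d) \<longlongrightarrow> D + r * A) (at_right A)"
    by (intro tendsto_intros)
  from order_tendstoD(2)[OF this c] eventually_at_right_less[of A]
  have "\<forall>\<^sub>F d in at_right A. D + r * d < c \<and> A < d" by eventually_elim simp
  then obtain d where d: "D + r * d < c" "A < d"
    using eventually_happens[of _ "at_right A"] by auto
  have "filterlim t (at_right 0) sequentially"
    using t by (auto simp: filterlim_at less_imp_neq[symmetric] intro!: always_eventually)
  from filterlim_iff[THEN iffD1, OF this, rule_format, OF A[OF d(2)]]
  have ev: "\<forall>\<^sub>F k in sequentially. (\<psi> (x + t k *\<^sub>R v) - \<psi> x) / (1/2 * (t k)\<^sup>2) < d" .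
  have "(\<lambda>k. (\<psi> (x + t k *\<^sub>R v + \<tau> k *\<^sub>R wk k) - \<psi> (x + t k *\<^sub>R v)) / \<tau> k + rk k * d) \<longlonglongrightarrow> D + r * d"
    by (intro tendsto_intros D r)
  from order_tendstoD(2)[OF this d(1)] ev show ?thesis
  proof eventually_elim
    case (elim k)
    have eq: "(X - Z) / \<tau> k = (X - Y) / \<tau> k + rk k * ((Y - Z) / (1/2 * (t k)\<^sup>2))" for X Y Z :: real
      using r(2)[of k] t(2)[of k] by (simp add: \<tau> field_simps)
    have "rk k * ((\<psi> (x + t k *\<^sub>R v) - \<psi> x) / (1/2 * (t k)\<^sup>2)) < rk k * d"
      using elim(2) r(2)[of k] by (rule mult_strict_left_mono)
    with elim(1) show ?case
      unfolding eq[of _ "\<psi> x" "\<psi> (x + t k *\<^sub>R v)"] by linarith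
  qed
qed

section \<open>The multiplier rule\<close>

theorem theorem3p2:
  fixes U :: "'z::banach set"
    and f F :: "'z \<Rightarrow> real^'p"
    and m l :: nat
    and g h :: "nat \<Rightarrow> 'z \<Rightarrow> real"
    and x0 v :: 'z
    and s :: "real^'p"
    and F' :: "'p \<Rightarrow> 'z \<Rightarrow> ('z \<Rightarrow>\<^sub>L real)"
    and F'' :: "'p \<Rightarrow> 'z \<Rightarrow> 'z \<Rightarrow> real"
    and f' :: "'p \<Rightarrow> ('z \<Rightarrow>\<^sub>L real)"
    and g' h' :: "nat \<Rightarrow> ('z \<Rightarrow>\<^sub>L real)"
  defines "X \<equiv> feasible_set U m g l h"
  assumes reflexive: "reflexive_space TYPE('z)"
    and U: "open U" "U \<noteq> {}"
    and F_pos: "\<forall>x\<in>U. \<forall>i. 0 < F x $ i"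
    and x0: "x0 \<in> U" "borwein_properly_efficient (ratio f F) X x0"
    and s: "\<forall>i. s $ i = f x0 $ i / F x0 $ i"
    and lip_f: "\<forall>i. locally_lipschitz_on U (\<lambda>x. f x $ i)"
    and lip_F: "\<forall>i. locally_lipschitz_on U (\<lambda>x. F x $ i)"
    and lip_g: "\<forall>j\<in>{1..m}. locally_lipschitz_on U (g j)"
    and lip_h: "\<forall>k\<in>{1..l}. locally_lipschitz_on U (h k)"
    and reg_f: "\<forall>i. \<forall>x\<in>U. clarke_regular (\<lambda>x. f x $ i) x"
    and reg_F: "\<forall>i. \<forall>x\<in>U. clarke_regular (\<lambda>x. F x $ i) x"
    and reg_g: "\<forall>j\<in>{1..m}. \<forall>x\<in>U. clarke_regular (g j) x"
    and reg_h: "\<forall>k\<in>{1..l}. \<forall>x\<in>U. clarke_regular (h k) x"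
    and fin_f: "\<forall>i. \<forall>x\<in>U. \<forall>d. \<bar>pz_deriv (\<lambda>x. f x $ i) x d\<bar> \<noteq> \<infinity>"
    and fin_g: "\<forall>j\<in>{1..m}. \<forall>x\<in>U. \<forall>d. \<bar>pz_deriv (g j) x d\<bar> \<noteq> \<infinity>"
    and fin_h: "\<forall>k\<in>{1..l}. \<forall>x\<in>U. \<forall>d. \<bar>pz_deriv (h k) x d\<bar> \<noteq> \<infinity>"
    and F': "\<forall>i. \<forall>x\<in>U. has_gateaux_derivative (\<lambda>x. F x $ i) (F' i x) x"
    and F'': "\<forall>i. \<forall>x\<in>U. \<forall>d. has_second_dirderiv (\<lambda>x. F x $ i) x d (F'' i x d)"
    and f': "\<forall>i. has_gateaux_derivative (\<lambda>x. f x $ i) (f' i) x0"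
    and g': "\<forall>j\<in>{1..m}. has_gateaux_derivative (g j) (g' j) x0"
    and h': "\<forall>k\<in>{1..l}. has_gateaux_derivative (h k) (h' k) x0"
    and v: "v \<in> critical_points X (ratio f F) m g l h x0"
    and abadie: "proj_second_linearizing_cone (ratio f F) m g l h x0 v
                   \<subseteq> proj_second_tangent_cone X x0 v"
  shows "\<exists>(lam :: real^'p) (\<mu> :: nat \<Rightarrow> real) (\<nu> :: nat \<Rightarrow> real).
           (\<forall>i. 0 < lam $ i) \<and> (\<forall>j\<in>{1..m}. 0 \<le> \<mu> j) \<and>
           (\<Sum>i\<in>UNIV. lam $ i *\<^sub>R (f' i - s $ i *\<^sub>R F' i x0))
             + (\<Sum>j=1..m. \<mu> j *\<^sub>R g' j) + (\<Sum>k=1..l. \<nu> k *\<^sub>R h' k) = 0 \<and>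
           (\<Sum>i\<in>UNIV. ereal (lam $ i) *
               (pz_deriv (\<lambda>x. f x $ i) x0 v - ereal (s $ i * F'' i x0 v)))
             + (\<Sum>j=1..m. ereal (\<mu> j) * pz_deriv (g j) x0 v)
             + (\<Sum>k=1..l. ereal (\<nu> k) * pz_deriv (h k) x0 v) \<ge> 0 \<and>
           (\<forall>j\<in>{1..m}. \<mu> j * g j x0 = 0 \<and> \<mu> j * blinfun_apply (g' j) v = 0)"
proof -
  \<comment> \<open>Finiteness of the second-order derivatives lets the argument run in the reals.
    \<open>A\<close> and \<open>D\<close> are the coefficients of the conclusion, that is, the data
    of the ratio multiplied by \<open>F x0 $ i\<close>.\<close>
  define A where "A i = real_of_ereal (pz_deriv (\<lambda>x. f x $ i) x0 v) - s $ i * F'' i x0 v" for i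
  define B where "B j = real_of_ereal (pz_deriv (g j) x0 v)" for j
  define C where "C k = real_of_ereal (pz_deriv (h k) x0 v)" for k
  define D where "D i w = blinfun_apply (f' i) w - s $ i * blinfun_apply (F' i x0) w" for i w
  have A: "pz_deriv (\<lambda>x. f x $ i) x0 v = ereal (A i + s $ i * F'' i x0 v)" for i
    using fin_f x0(1) by (simp add: A_def ereal_real')
  have B: "pz_deriv (g j) x0 v = ereal (B j)" if "j \<in> {1..m}" for j
    using fin_g x0(1) that by (simp add: B_def ereal_real')
  have C: "pz_deriv (h k) x0 v = ereal (C k)" if "k \<in> {1..l}" for k
    using fin_h x0(1) that by (simp add: C_def ereal_real')
  have F0: "0 < F x0 $ i" for i using F_pos x0(1) by simp
  have s': "f x0 $ i / F x0 $ i = s $ i" for i using s by simp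
  have reg: "clarke_regular (\<lambda>x. f x $ i) x0" "clarke_regular (\<lambda>x. F x $ i) x0"
    and gat: "has_gateaux_derivative (\<lambda>x. f x $ i) (f' i) x0"
      "has_gateaux_derivative (\<lambda>x. F x $ i) (F' i x0) x0"
    and lip: "locally_lipschitz_on U (\<lambda>x. f x $ i)" "locally_lipschitz_on U (\<lambda>x. F x $ i)" for i
    using reg_f reg_F f' F' lip_f lip_F x0(1) by simp_all
  have cont: "isCont (\<lambda>x. f x $ i) x0" "isCont (\<lambda>x. F x $ i) x0" for i
    using locally_lipschitz_on_isCont[OF lip(1) U(1) x0(1)]
      locally_lipschitz_on_isCont[OF lip(2) U(1) x0(1)] by simp_all
  have c\<psi>: "clarke_deriv (\<lambda>x. ratio f F x $ i) x0 w = ereal (D i w / F x0 $ i)" for i w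
    using clarke_deriv_quotient[where w = w, OF reg(1)[of i] gat(1) cont(1) reg(2)[of i] gat(2) cont(2)
        less_imp_neq[OF F0, symmetric]]
    by (simp add: ratio_def s' D_def)
  have cg: "clarke_deriv (g j) x0 w = ereal (blinfun_apply (g' j) w)" if "j \<in> {1..m}" for j w
    using clarke_deriv_gateaux[of "g j" x0 "g' j"] reg_g g' x0(1) that by simp
  have ch: "clarke_deriv (h k) x0 w = ereal (blinfun_apply (h' k) w)" if "k \<in> {1..l}" for k w
    using clarke_deriv_gateaux[of "h k" x0 "h' k"] reg_h h' x0(1) that by simp
  have seq: "(\<lambda>k. (ratio f F (y k + t k *\<^sub>R wk k) $ i - ratio f F (y k) $ i) / t k) \<longlonglongrightarrow> D i w / F x0 $ i"
    if "y \<longlonglongrightarrow> x0" "t \<longlonglongrightarrow> 0" "\<And>k. 0 < t k" "wk \<longlonglongrightarrow> w" for y t wk w i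
    using strict_derivative_quotient_sequence[OF reg(1)[of i] gat(1) lip(1) reg(2)[of i] gat(2) lip(2)
        less_imp_neq[OF F0, symmetric] U(1) x0(1) that]
    by (simp add: ratio_def s' D_def)

  \<comment> \<open>Along a feasible sequence realizing \<open>v\<close>, the quotients of the ratio
    converge to \<open>D i v / F x0 $ i\<close>. These limits are nonpositive because
    \<open>v\<close> lies in the linearizing cone, so proper efficiency makes them zero.\<close>
  have Dv: "D i v = 0" for i
  proof -
    obtain t d where t: "\<And>k. 0 < t k" "t \<longlonglongrightarrow> 0" and d: "d \<longlonglongrightarrow> v" "\<And>k. x0 + t k *\<^sub>R d k \<in> X"
      using v unfolding critical_points_def contingent_cone_def by blast
    have "(\<chi> i. D i v / F x0 $ i) = 0"
    proof (rule borwein_upper_limit_eq_0[OF x0(2) t d(2)])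
      fix i c assume "(\<chi> i. D i v / F x0 $ i) $ i < c"
      with order_tendstoD(2)[OF seq[OF tendsto_const t(2,1) d(1), of i]]
      show "\<forall>\<^sub>F k in sequentially. (ratio f F (x0 + t k *\<^sub>R d k) $ i - ratio f F x0 $ i) / t k < c"
        by simp
    next
      fix i
      have "clarke_deriv (\<lambda>x. ratio f F x $ i) x0 v \<le> 0"
        using v unfolding critical_points_def linearizing_cone_def by simp
      then show "(\<chi> i. D i v / F x0 $ i) $ i \<le> 0" by (simp add: c\<psi>)
    qed
    from arg_cong[OF this, of "\<lambda>b. b $ i"] show ?thesis using F0[of i] by simp
  qed

  have up: "\<forall>\<^sub>F t in at_right 0. (ratio f F (x0 + t *\<^sub>R v) $ i - ratio f F x0 $ i) / (1/2 * t\<^sup>2) < c"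
    if "A i / F x0 $ i < c" for i c
  proof -
    have "has_second_dirderiv (\<lambda>x. F x $ i) x0 v (F'' i x0 v)" using F'' x0(1) by simp
    moreover have "blinfun_apply (f' i) v = f x0 $ i / F x0 $ i * blinfun_apply (F' i x0) v"
      using Dv[of i] by (simp add: D_def s')
    moreover have "(A i + s $ i * F'' i x0 v - f x0 $ i / F x0 $ i * F'' i x0 v) / F x0 $ i < c"
      using that by (simp add: s')
    ultimately show ?thesis
      using pz_quotient_upper_bound[OF reg(1) gat(1) _ gat(2) cont(2) F0 eq_refl[OF A]]
      by (simp only: ratio_def vec_lambda_beta)
  qed
  \<comment> \<open>Since the Clarke derivative of the ratio vanishes at \<open>v\<close>, its
    second-order quotient is precisely the one bounded in \<open>up\<close>.\<close>
  have pz\<psi>: "pz_deriv (\<lambda>x. ratio f F x $ i) x0 v \<le> ereal (A i / F x0 $ i)" for i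
    using pz_deriv_le_iff[of "\<lambda>x. ratio f F x $ i" x0 v 0 "A i / F x0 $ i"] up[of i] c\<psi>[of i v] Dv[of i]
    by simp

  have primal: "D i w + r * A i = 0"
    if r: "0 \<le> r" and le: "\<And>i. D i w + r * A i \<le> 0"
      and gle: "\<And>j. j \<in> active_dir m g x0 v \<Longrightarrow> blinfun_apply (g' j) w + r * B j \<le> 0"
      and heq: "\<And>k. k \<in> {1..l} \<Longrightarrow> blinfun_apply (h' k) w + r * C k = 0" for w r i
  proof -
    have b_eq: "D i w / F x0 $ i + r * (A i / F x0 $ i) = (D i w + r * A i) / F x0 $ i" for i
      by (simp add: add_divide_distrib)
    have b_le: "D i w / F x0 $ i + r * (A i / F x0 $ i) \<le> 0" for i
      unfolding b_eq using le[of i] F0[of i] by (simp add: divide_le_0_iff)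
    have "(w, r) \<in> proj_second_linearizing_cone (ratio f F) m g l h x0 v"
      unfolding proj_second_linearizing_cone_def mem_Collect_eq prod.case
    proof (intro conjI allI ballI r)
      fix i
      \<comment> \<open>Only an upper bound for the second-order derivative of the ratio is known;
        \<open>0 \<le> r\<close> keeps its direction.\<close>
      have "clarke_deriv (\<lambda>x. ratio f F x $ i) x0 w + ereal r * pz_deriv (\<lambda>x. ratio f F x $ i) x0 v
          \<le> ereal (D i w / F x0 $ i) + ereal r * ereal (A i / F x0 $ i)"
        unfolding c\<psi> using r by (intro add_left_mono ereal_mult_left_mono pz\<psi>) simp
      also have "\<dots> \<le> 0" using b_le[of i] by simp
      finally show "clarke_deriv (\<lambda>x. ratio f F x $ i) x0 w
          + ereal r * pz_deriv (\<lambda>x. ratio f F x $ i) x0 v \<le> 0" .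
    next
      fix j assume j: "j \<in> active_dir m g x0 v"
      then have "j \<in> {1..m}" by (simp add: active_dir_def active_def)
      then show "clarke_deriv (g j) x0 w + ereal r * pz_deriv (g j) x0 v \<le> 0"
        using gle[OF j] by (simp add: cg B)
    next
      fix k assume k: "k \<in> {1..l}"
      then show "clarke_deriv (h k) x0 w + ereal r * pz_deriv (h k) x0 v = 0"
        using heq[OF k] by (simp add: ch C)
    qed
    from subsetD[OF abadie this] have "(w, r) \<in> proj_second_tangent_cone X x0 v" .
    then have "\<exists>t rk wk. (\<forall>k. 0 < t k) \<and> t \<longlonglongrightarrow> 0 \<and> rk \<longlonglongrightarrow> r \<and> wk \<longlonglongrightarrow> w \<and>
        (\<forall>k. 0 < rk k) \<and> (\<lambda>k. t k / rk k) \<longlonglongrightarrow> 0 \<and>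
        (\<forall>k. x0 + t k *\<^sub>R v + (1/2 * inverse (rk k) * (t k)\<^sup>2) *\<^sub>R wk k \<in> X)"
      unfolding proj_second_tangent_cone_def mem_Collect_eq prod.case by (rule conjunct2)
    then obtain t rk wk where seqs: "(\<forall>k. 0 < t k) \<and> t \<longlonglongrightarrow> 0 \<and> rk \<longlonglongrightarrow> r \<and> wk \<longlonglongrightarrow> w \<and>
        (\<forall>k. 0 < rk k) \<and> (\<lambda>k. t k / rk k) \<longlonglongrightarrow> 0 \<and>
        (\<forall>k. x0 + t k *\<^sub>R v + (1/2 * inverse (rk k) * (t k)\<^sup>2) *\<^sub>R wk k \<in> X)"
      by (elim exE)
    note t = seqs[THEN conjunct1, THEN spec] seqs[THEN conjunct2, THEN conjunct1]
    note seqs' = seqs[THEN conjunct2, THEN conjunct2]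
    note rk = seqs'[THEN conjunct1] seqs'[THEN conjunct2, THEN conjunct2, THEN conjunct1, THEN spec]
    note wk = seqs'[THEN conjunct2, THEN conjunct1]
    note tr = seqs'[THEN conjunct2, THEN conjunct2, THEN conjunct2, THEN conjunct1]
    note X = seqs'[THEN conjunct2, THEN conjunct2, THEN conjunct2, THEN conjunct2, THEN spec]
    define \<tau> where "\<tau> k = 1/2 * inverse (rk k) * (t k)\<^sup>2" for k
    have \<tau>_pos: "0 < \<tau> k" for k using t(1)[of k] rk(2)[of k] by (simp add: \<tau>_def)
    \<comment> \<open>The condition that \<open>t / rk\<close> tends to 0 makes
      \<open>\<tau>\<close> vanish in the limit even when \<open>rk\<close> tends to 0.\<close>
    have "(\<lambda>k. 1/2 * (t k / rk k) * t k) \<longlonglongrightarrow> 1/2 * 0 * 0"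
      by (intro tendsto_mult tendsto_const tr t(2))
    moreover have "1/2 * (t k / rk k) * t k = \<tau> k" for k
      by (simp add: \<tau>_def field_simps power2_eq_square)
    ultimately have \<tau>_lim: "\<tau> \<longlonglongrightarrow> 0" by simp
    have "(\<lambda>k. x0 + t k *\<^sub>R v) \<longlonglongrightarrow> x0 + 0 *\<^sub>R v" by (intro tendsto_intros t)
    then have y: "(\<lambda>k. x0 + t k *\<^sub>R v) \<longlonglongrightarrow> x0" by simp
    have "(\<chi> i. D i w / F x0 $ i + r * (A i / F x0 $ i)) = 0"
    proof (rule borwein_upper_limit_eq_0[OF x0(2) \<tau>_pos \<tau>_lim X[folded \<tau>_def]])
      fix i c assume "(\<chi> i. D i w / F x0 $ i + r * (A i / F x0 $ i)) $ i < c"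
      then have "D i w / F x0 $ i + r * (A i / F x0 $ i) < c" by simp
      then show "\<forall>\<^sub>F k in sequentially.
          (ratio f F (x0 + t k *\<^sub>R v + \<tau> k *\<^sub>R wk k) $ i - ratio f F x0 $ i) / \<tau> k < c"
        using second_order_arc_upper_bound[OF t(2,1) rk \<tau>_def seq[OF y \<tau>_lim \<tau>_pos wk] up] by simp
    next
      show "(\<chi> i. D i w / F x0 $ i + r * (A i / F x0 $ i)) $ i \<le> 0" for i
        using b_le[of i] by (simp only: vec_lambda_beta)
    qed
    from arg_cong[OF this, of "\<lambda>b. b $ i"] have "(D i w + r * A i) / F x0 $ i = 0"
      by (simp only: vec_lambda_beta b_eq zero_index)
    then show ?thesis using F0[of i] by simp
  qed

  txt \<open>Index \<open>0\<close>, which is not a constraint index, stands for the inequality \<open>- r \<le> 0\<close>.\<close>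
  define p where "p i z = D i (fst z) + snd z * A i" for i and z :: "'z \<times> real"
  define a where "a j z = (if j = 0 then - snd z else blinfun_apply (g' j) (fst z) + snd z * B j)"
    for j and z :: "'z \<times> real"
  define e where "e k z = blinfun_apply (h' k) (fst z) + snd z * C k" for k and z :: "'z \<times> real"
  define J where "J = active_dir m g x0 v"
  have J: "J \<subseteq> {1..m}" by (auto simp: J_def active_dir_def active_def)
  then have J0: "finite J" "0 \<notin> J" using finite_subset by auto
  have "\<exists>lam \<mu> \<nu>. (\<forall>i\<in>UNIV. 0 < lam i) \<and> (\<forall>j\<in>insert 0 J. 0 \<le> \<mu> j) \<and>
    (\<forall>z. (\<Sum>i\<in>UNIV. lam i * p i z) + (\<Sum>j\<in>insert 0 J. \<mu> j * a j z) + (\<Sum>k\<in>{1..l}. \<nu> k * e k z) = 0)"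
  proof (rule tucker_alternative)
    show "linear (p i)" for i
      unfolding p_def D_def by (rule linearI) (simp_all add: blinfun.bilinear_simps algebra_simps)
    show "linear (a j)" for j
      unfolding a_def by (rule linearI) (simp_all add: blinfun.bilinear_simps algebra_simps)
    show "linear (e k)" for k
      unfolding e_def by (rule linearI) (simp_all add: blinfun.bilinear_simps algebra_simps)
    show "p i z = 0" if P: "\<And>i. i \<in> UNIV \<Longrightarrow> p i z \<le> 0" and Q: "\<And>j. j \<in> insert 0 J \<Longrightarrow> a j z \<le> 0"
      and E: "\<And>k. k \<in> {1..l} \<Longrightarrow> e k z = 0" for z i
      unfolding p_def
    proof (rule primal)
      show "0 \<le> snd z" using Q[of 0] by (simp add: a_def)
      show "D i (fst z) + snd z * A i \<le> 0" for i using P[of i] by (simp add: p_def)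
      show "blinfun_apply (g' j) (fst z) + snd z * B j \<le> 0" if "j \<in> active_dir m g x0 v" for j
        using Q[of j] that J0 by (auto simp: a_def J_def split: if_splits)
      show "blinfun_apply (h' k) (fst z) + snd z * C k = 0" if "k \<in> {1..l}" for k
        using E[OF that] by (simp add: e_def)
    qed
  qed (use J0 in auto)
  then obtain lam \<mu> \<nu> where mult: "(\<forall>i\<in>UNIV. 0 < lam i) \<and> (\<forall>j\<in>insert 0 J. 0 \<le> \<mu> j) \<and>
    (\<forall>z. (\<Sum>i\<in>UNIV. lam i * p i z) + (\<Sum>j\<in>insert 0 J. \<mu> j * a j z) + (\<Sum>k\<in>{1..l}. \<nu> k * e k z) = 0)"
    by (elim exE)
  have lam: "0 < lam i" for i using mult by simp
  have \<mu>: "0 \<le> \<mu> j" if "j \<in> insert 0 J" for j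
    by (rule mult[THEN conjunct2, THEN conjunct1, THEN bspec, OF that])
  have eq: "(\<Sum>i\<in>UNIV. lam i * p i z) + (\<Sum>j\<in>insert 0 J. \<mu> j * a j z) + (\<Sum>k\<in>{1..l}. \<nu> k * e k z) = 0" for z
    by (rule mult[THEN conjunct2, THEN conjunct2, THEN spec])
  \<comment> \<open>Extension by zero outside \<open>J\<close> yields both complementarity
    conditions, because indices in \<open>J\<close> satisfy \<open>g j x0 = 0\<close> and
    \<open>g' j v = 0\<close>. The auxiliary index 0 is dropped here.\<close>
  define \<mu>' where "\<mu>' j = (if j \<in> J then \<mu> j else 0)" for j
  have sumJ: "(\<Sum>j=1..m. \<mu>' j * q j) = (\<Sum>j\<in>J. \<mu> j * q j)" for q :: "nat \<Rightarrow> real"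
    using J by (intro sum.mono_neutral_cong_right) (auto simp: \<mu>'_def)
  \<comment> \<open>Evaluation at \<open>(w, 0)\<close> removes all second-order terms and the
    auxiliary inequality.\<close>
  have eq1: "(\<Sum>i\<in>UNIV. lam i * D i w) + (\<Sum>j=1..m. \<mu>' j * blinfun_apply (g' j) w)
      + (\<Sum>k=1..l. \<nu> k * blinfun_apply (h' k) w) = 0" for w
  proof -
    have "(\<Sum>j\<in>J. \<mu> j * a j (w, 0)) = (\<Sum>j\<in>J. \<mu> j * blinfun_apply (g' j) w)"
      using J0 by (intro sum.cong) (auto simp: a_def)
    moreover have "a 0 (w, 0) = 0" by (simp add: a_def)
    ultimately show ?thesis
      unfolding sumJ using eq[of "(w, 0)"] J0 by (simp add: p_def e_def)
  qed
  \<comment> \<open>Evaluation at \<open>(0, 1)\<close> leaves \<open>- \<mu> 0\<close> from the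
    auxiliary inequality, so the remaining sum equals \<open>\<mu> 0\<close>, which is
    nonnegative.\<close>
  have eq2: "(\<Sum>i\<in>UNIV. lam i * A i) + (\<Sum>j=1..m. \<mu>' j * B j) + (\<Sum>k=1..l. \<nu> k * C k) \<ge> 0"
  proof -
    have "(\<Sum>j\<in>J. \<mu> j * a j (0, 1)) = (\<Sum>j\<in>J. \<mu> j * B j)"
      using J0 by (intro sum.cong) (auto simp: a_def)
    moreover have "a 0 (0, 1) = -1" by (simp add: a_def)
    ultimately show ?thesis
      unfolding sumJ using eq[of "(0, 1)"] J0 \<mu>[of 0] by (simp add: p_def D_def e_def)
  qed
  show ?thesis
  proof (intro exI conjI ballI allI)
    show "0 < (\<chi> i. lam i) $ i" for i using lam by simp
    show "0 \<le> \<mu>' j" for j using \<mu> by (simp add: \<mu>'_def)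
    show "(\<Sum>i\<in>UNIV. (\<chi> i. lam i) $ i *\<^sub>R (f' i - s $ i *\<^sub>R F' i x0))
        + (\<Sum>j=1..m. \<mu>' j *\<^sub>R g' j) + (\<Sum>k=1..l. \<nu> k *\<^sub>R h' k) = 0"
      using eq1 by (intro blinfun_eqI) (simp add: blinfun.bilinear_simps blinfun.sum_left D_def)
    \<comment> \<open>All extended-real summands are finite, so each sum is the image of a real sum
      and \<open>eq2\<close> applies.\<close>
    have "(\<Sum>i\<in>UNIV. ereal ((\<chi> i. lam i) $ i) *
          (pz_deriv (\<lambda>x. f x $ i) x0 v - ereal (s $ i * F'' i x0 v))) = ereal (\<Sum>i\<in>UNIV. lam i * A i)"
      by (simp add: A)
    moreover have "(\<Sum>j=1..m. ereal (\<mu>' j) * pz_deriv (g j) x0 v) = ereal (\<Sum>j=1..m. \<mu>' j * B j)"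
      unfolding sum_ereal[symmetric] by (intro sum.cong refl) (simp add: B)
    moreover have "(\<Sum>k=1..l. ereal (\<nu> k) * pz_deriv (h k) x0 v) = ereal (\<Sum>k=1..l. \<nu> k * C k)"
      unfolding sum_ereal[symmetric] by (intro sum.cong refl) (simp add: C)
    ultimately show "(\<Sum>i\<in>UNIV. ereal ((\<chi> i. lam i) $ i) *
          (pz_deriv (\<lambda>x. f x $ i) x0 v - ereal (s $ i * F'' i x0 v)))
        + (\<Sum>j=1..m. ereal (\<mu>' j) * pz_deriv (g j) x0 v)
        + (\<Sum>k=1..l. ereal (\<nu> k) * pz_deriv (h k) x0 v) \<ge> 0"
      using eq2 by simp
    fix j assume j: "j \<in> {1..m}"
    show "\<mu>' j * g j x0 = 0" by (simp add: \<mu>'_def J_def active_dir_def active_def)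
    show "\<mu>' j * blinfun_apply (g' j) v = 0"
      using cg[OF j] by (auto simp: \<mu>'_def J_def active_dir_def)
  qed
qed

end
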